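(* Let $(X,d)$ be a compact totally disconnected metric space and let $f:X\to2^X$ be an expansive multivalued map. If $f$ has the shadowing property, then its orbit system $(\mathrm{Orb}_f(X),\sigma_f)$ is conjugate to a subshift of finite type.
   Context: $2^X$ is the set of non-empty closed subsets of $X$. A multivalued map is an upper semicontinuous $f:X\to 2^X$ (for every $x$ and open $U\supset f(x)$ there is an open neighborhood $V$ of $x$ with $f(y)\subset U$ for all $y\in V$). Let $\omega=\{0,1,2,\dots\}$. The orbit space is $\mathrm{Orb}_f(X)=\{(x_i)_{i\in\omega}\in\prod_{i\in\omega}X: x_{i+1}\in f(x_i)\text{ for all }i\in\omega\}$ with the topology inherited from the product, and $\sigma_f$ is the left shift $(x_i)_i\mapsto(x_{i+1})_i$ on it. An $f$-orbit of $x$ is an element of $\mathrm{Orb}_f(X)$ with $x_0=x$. $f$ is expansive if there is $\delta>0$ such that $x=y$ whenever there exist $f$-orbits $(x_i)$ of $x$ and $(y_i)$ of $y$ with $d(x_i,y_i)\le\delta$ for all $i\ge0$. $f$ has the shadowing property if for each $\varepsilon>0$ there is $\delta>0$ such that for every sequence $\{x_i\}_{i\ge0}$ in $X$ with $d(f(x_i),x_{i+1})<\delta$ for all $i$ (where $d(f(x_i),x_{i+1})=\inf\{d(x,x_{i+1}):x\in f(x_i)\}$), there is an $f$-orbit $(y_i)_{i\ge0}$ with $d(x_i,y_i)\le\varepsilon$ for all $i\ge0$. For a finite non-empty discrete set $S$, $S^\omega$ carries the product topology and the left shift $\sigma$. A subshift of finite type is a pair $(X_F,\sigma)$ where, for some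 finite alphabet $S$, some $M\in\mathbb N$ and some set $F$ of words over $S$ all of length $M+1$, $X_F$ is the set of all sequences in $S^\omega$ that contain no word of $F$. Two single-valued systems $(Y,T)$, $(Z,R)$ are conjugate if there is a homeomorphism $h:Y\to Z$ with $h\circ T=R\circ h$. *)

theory Defs
  imports "HOL-Analysis.Analysis"
begin

definition totally_disconnected :: "'a::topological_space set \<Rightarrow> bool" where
  "totally_disconnected X \<longleftrightarrow>
     (\<forall>C. C \<subseteq> X \<and> connected C \<longrightarrow> (\<forall>x\<in>C. \<forall>y\<in>C. x = y))"

text \<open>The space is a carrier set \<open>X\<close> in an ambient metric type; open and closed are always
  meant relative to \<open>X\<close>, and values of \<open>f\<close> outside \<open>X\<close> play no role.\<close>

definition upper_semicontinuous :: "'a::topological_space set \<Rightarrow> ('a \<Rightarrow> 'a set) \<Rightarrow> bool" where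
  "upper_semicontinuous X f \<longleftrightarrow>
     (\<forall>x\<in>X. \<forall>U. openin (top_of_set X) U \<and> f x \<subseteq> U \<longrightarrow>
        (\<exists>V. openin (top_of_set X) V \<and> x \<in> V \<and> (\<forall>y\<in>V. f y \<subseteq> U)))"

definition multivalued_map :: "'a::topological_space set \<Rightarrow> ('a \<Rightarrow> 'a set) \<Rightarrow> bool" where
  "multivalued_map X f \<longleftrightarrow>
     (\<forall>x\<in>X. f x \<noteq> {} \<and> closedin (top_of_set X) (f x)) \<and> upper_semicontinuous X f"

definition Orb :: "'a set \<Rightarrow> ('a \<Rightarrow> 'a set) \<Rightarrow> (nat \<Rightarrow> 'a) set" where
  "Orb X f = {x. (\<forall>i. x i \<in> X) \<and> (\<forall>i. x (Suc i) \<in> f (x i))}"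

definition orbit_space ::
    "'a::topological_space set \<Rightarrow> ('a \<Rightarrow> 'a set) \<Rightarrow> (nat \<Rightarrow> 'a) topology" where
  "orbit_space X f = subtopology (product_topology (\<lambda>_. top_of_set X) UNIV) (Orb X f)"

definition left_shift :: "(nat \<Rightarrow> 'a) \<Rightarrow> (nat \<Rightarrow> 'a)" where
  "left_shift x = (\<lambda>i. x (Suc i))"

definition expansive :: "'a::metric_space set \<Rightarrow> ('a \<Rightarrow> 'a set) \<Rightarrow> bool" where
  "expansive X f \<longleftrightarrow>
     (\<exists>\<delta>>0. \<forall>x\<in>X. \<forall>y\<in>X.
        (\<exists>u\<in>Orb X f. \<exists>v\<in>Orb X f. u 0 = x \<and> v 0 = y \<and> (\<forall>i. dist (u i) (v i) \<le> \<delta>))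
        \<longrightarrow> x = y)"

text \<open>\<open>infdist z A\<close> is \<open>0\<close> for empty \<open>A\<close>; this case cannot
  occur for a multivalued map.\<close>

definition shadowing_property :: "'a::metric_space set \<Rightarrow> ('a \<Rightarrow> 'a set) \<Rightarrow> bool" where
  "shadowing_property X f \<longleftrightarrow>
     (\<forall>\<epsilon>>0. \<exists>\<delta>>0. \<forall>x::nat \<Rightarrow> 'a.
        (\<forall>i. x i \<in> X) \<and> (\<forall>i. infdist (x (Suc i)) (f (x i)) < \<delta>)
        \<longrightarrow> (\<exists>y\<in>Orb X f. \<forall>i. dist (x i) (y i) \<le> \<epsilon>))"

definition contains_word :: "(nat \<Rightarrow> 's) \<Rightarrow> 's list \<Rightarrow> bool" where
  "contains_word x w \<longleftrightarrow> (\<exists>i. \<forall>j<length w. x (i + j) = w ! j)"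

text \<open>Every finite alphabet can be renamed into a finite subset of \<open>nat\<close>, so
  \<open>'s = nat\<close> covers all subshifts of finite type up to conjugacy.\<close>

definition SFT_space :: "'s set \<Rightarrow> 's list set \<Rightarrow> (nat \<Rightarrow> 's) topology" where
  "SFT_space S F = subtopology (product_topology (\<lambda>_. discrete_topology S) UNIV)
     {x. (\<forall>i. x i \<in> S) \<and> (\<forall>w\<in>F. \<not> contains_word x w)}"

definition subshift_of_finite_type ::
    "(nat \<Rightarrow> 's) topology \<Rightarrow> ((nat \<Rightarrow> 's) \<Rightarrow> (nat \<Rightarrow> 's)) \<Rightarrow> bool" where
  "subshift_of_finite_type Y T \<longleftrightarrow>
     (\<exists>S (M::nat) F. finite S \<and> S \<noteq> {} \<and>
        (\<forall>w\<in>F. length w = M + 1 \<and> set w \<subseteq> S) \<and>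
        Y = SFT_space S F \<and> T = left_shift)"

definition conjugate ::
    "'a topology \<Rightarrow> ('a \<Rightarrow> 'a) \<Rightarrow> 'b topology \<Rightarrow> ('b \<Rightarrow> 'b) \<Rightarrow> bool" where
  "conjugate Y T Z R \<longleftrightarrow>
     (\<exists>h. homeomorphic_map Y Z h \<and> (\<forall>y\<in>topspace Y. h (T y) = R (h y)))"

end

theory Submission
  imports Defs
begin

text \<open>Split \<open>X\<close> into finitely many clopen cells of diameter at most the expansivity
  constant and record the itinerary of an orbit through the cells. Expansivity makes this coding
  injective and, by compactness, makes long finite itineraries determine the first point up to any
  prescribed precision. Hence, if every word of a certain length of a symbol sequence occurs in some
  orbit, the first points of those orbits form a pseudo-orbit. The orbit shadowing it at a scale
  below the distances between cells has the given sequence as its itinerary.\<close>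

section \<open>Clopen codings\<close>

text \<open>In a compact Hausdorff space quasi-components and connected components coincide, and
  here the components are single points. The two halves are given as ambient open sets, so that
  products of them can cover a compact subset of \<open>X \<times> X\<close>.\<close>

lemma clopen_separation:
  fixes X :: "'a::metric_space set"
  assumes "compact X" "totally_disconnected X" "x \<in> X" "y \<in> X" "x \<noteq> y"
  obtains U V where "open U" "open V" "X \<subseteq> U \<union> V" "X \<inter> U \<inter> V = {}" "x \<in> U" "y \<in> V"
proof -
  let ?T = "top_of_set X"
  have "compact_space ?T" "Hausdorff_space ?T"
    using assms(1) by (simp_all add: compact_space_subtopology Hausdorff_space_subtopology)
  then have "quasi_component_of ?T x = connected_component_of ?T x"
    using quasi_eq_connected_components_of[of ?T] assms(3)
    by (simp add: quasi_eq_connected_components_of_pointwise)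
  moreover have "\<not> connected_component_of ?T x y"
    using assms(2,5)
    by (auto simp: connected_component_of_def totally_disconnected_def connectedin_subtopology)
  ultimately have "\<not> quasi_component_of ?T x y" by simp
  then obtain U V where "openin ?T U" "openin ?T V" "U \<union> V = X" "disjnt U V" "x \<in> U" "y \<in> V"
    unfolding quasi_component_of_alt using assms by auto
  then obtain U' V' where "open U'" "open V'" "U = X \<inter> U'" "V = X \<inter> V'"
    by (auto simp: openin_open)
  with \<open>U \<union> V = X\<close> \<open>disjnt U V\<close> \<open>x \<in> U\<close> \<open>y \<in> V\<close> show thesis
    by (intro that[of U' V']) (auto simp: disjnt_def)
qed

text \<open>Pairs of points far apart form a compact set, so finitely many clopen partitions
  separate all of them. Recording the side of each partition on which a point lies gives the coding.
  Its values lie in the discrete type \<open>nat\<close>, so continuity means local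
  constancy.\<close>

lemma clopen_coding_exists:
  fixes X :: "'a::metric_space set"
  assumes "compact X" "totally_disconnected X" "\<delta> > 0"
  obtains \<pi> :: "'a \<Rightarrow> nat" where "continuous_on X \<pi>"
    and "\<And>a b. a \<in> X \<Longrightarrow> b \<in> X \<Longrightarrow> \<pi> a = \<pi> b \<Longrightarrow> dist a b \<le> \<delta>"
proof -
  \<comment> \<open>The non-strict inequality makes \<open>K\<close> closed;
    \<open>\<delta> > 0\<close> keeps it off the diagonal, where no partition could
    separate.\<close>
  define K where "K = (X \<times> X) \<inter> {p. \<delta> \<le> dist (fst p) (snd p)}"
  define C where "C = {p. open (fst p) \<and> open (snd p) \<and> X \<subseteq> fst p \<union> snd p \<and> X \<inter> fst p \<inter> snd p = {}}"
  have "closed {p :: 'a \<times> 'a. \<delta> \<le> dist (fst p) (snd p)}"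
    by (intro closed_Collect_le continuous_intros)
  then have 1: "compact K"
    unfolding K_def by (intro compact_Int_closed compact_Times assms)
  have 2: "K \<subseteq> (\<Union>p\<in>C. fst p \<times> snd p)"
  proof
    fix q assume q: "q \<in> K"
    then have "fst q \<in> X" "snd q \<in> X" "fst q \<noteq> snd q" using assms(3) by (auto simp: K_def)
    then obtain U V where "open U" "open V" "X \<subseteq> U \<union> V" "X \<inter> U \<inter> V = {}" "fst q \<in> U" "snd q \<in> V"
      using clopen_separation[OF assms(1,2)] by metis
    then have "(U, V) \<in> C" "q \<in> fst (U, V) \<times> snd (U, V)"
      by (auto simp: C_def mem_Times_iff)
    then show "q \<in> (\<Union>p\<in>C. fst p \<times> snd p)" by blast
  qed
  have "\<And>p. p \<in> C \<Longrightarrow> open (fst p \<times> snd p)" by (simp add: C_def open_Times)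
  from compactE_image[of K C "\<lambda>p. fst p \<times> snd p", OF 1 this 2]
  obtain D where D: "D \<subseteq> C" "finite D" "K \<subseteq> (\<Union>p\<in>D. fst p \<times> snd p)" .
  define code where "code x = {p \<in> D. x \<in> fst p}" for x
  obtain g :: "_ \<Rightarrow> nat" where g: "inj_on g (Pow D)"
    using finite_imp_inj_to_nat_seg[of "Pow D"] D(2) by auto
  show thesis
  proof (rule that[of "g \<circ> code"])
    show "continuous_on X (g \<circ> code)"
      unfolding continuous_on_def
    proof
      fix x assume x: "x \<in> X"
      \<comment> \<open>The sides containing \<open>x\<close>, one from each of the finitely many
        partitions, intersect in a neighbourhood on which \<open>code\<close> is constant.\<close>
      define W where "W = (\<Inter>p\<in>D. if x \<in> fst p then fst p else snd p)"
      have "open W" unfolding W_def using D by (intro open_INT) (auto simp: C_def)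
      moreover have "x \<in> W" using x D(1) by (auto simp: W_def C_def)
      moreover have "code y = code x" if y: "y \<in> X" "y \<in> W" for y
      proof -
        have "y \<in> fst p \<longleftrightarrow> x \<in> fst p" if p: "p \<in> D" for p
        proof -
          have "y \<in> (if x \<in> fst p then fst p else snd p)" using y(2) p by (auto simp: W_def)
          moreover have "X \<inter> fst p \<inter> snd p = {}" using p D(1) by (auto simp: C_def)
          ultimately show ?thesis using y(1) by (auto split: if_splits)
        qed
        then show ?thesis by (auto simp: code_def)
      qed
      ultimately have "\<forall>\<^sub>F y in at x within X. (g \<circ> code) y = (g \<circ> code) x"
        unfolding eventually_at_topological by fastforce
      then show "((g \<circ> code) \<longlongrightarrow> (g \<circ> code) x) (at x within X)" by (rule tendsto_eventually)
    qed
  next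
    fix a b assume ab: "a \<in> X" "b \<in> X" "(g \<circ> code) a = (g \<circ> code) b"
    then have eq: "code a = code b"
      using inj_onD[OF g, of "code a" "code b"] by (auto simp: code_def)
    show "dist a b \<le> \<delta>"
    proof (rule ccontr)
      assume "\<not> dist a b \<le> \<delta>"
      then have "(a, b) \<in> K" using ab by (auto simp: K_def)
      then obtain p where p: "p \<in> D" "a \<in> fst p" "b \<in> snd p" using D(3) by auto
      then have "b \<in> fst p" using eq by (auto simp: code_def)
      then show False using p D(1) ab by (auto simp: C_def)
    qed
  qed
qed

text \<open>Distinct naturals are at distance at least 1, so uniform continuity with tolerance 1
  already forces equal codes.\<close>

lemma locally_constant_uniform:
  fixes \<pi> :: "'a::metric_space \<Rightarrow> nat"
  assumes "compact X" "continuous_on X \<pi>"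
  obtains \<epsilon> where "\<epsilon> > 0" "\<And>a b. a \<in> X \<Longrightarrow> b \<in> X \<Longrightarrow> dist a b \<le> \<epsilon> \<Longrightarrow> \<pi> a = \<pi> b"
proof -
  have "continuous_on X (\<lambda>x. real (\<pi> x))" using assms(2) by (intro continuous_on_of_nat)
  then have "uniformly_continuous_on X (\<lambda>x. real (\<pi> x))"
    using assms(1) by (rule compact_uniformly_continuous)
  then obtain d where d: "d > 0" "\<And>a b. a \<in> X \<Longrightarrow> b \<in> X \<Longrightarrow> dist b a < d \<Longrightarrow>
      dist (real (\<pi> b)) (real (\<pi> a)) < 1"
    unfolding uniformly_continuous_on_def by (metis zero_less_one)
  show thesis
  proof (rule that[of "d / 2"])
    show "\<pi> a = \<pi> b" if "a \<in> X" "b \<in> X" "dist a b \<le> d / 2" for a b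
    proof -
      have "dist (real (\<pi> a)) (real (\<pi> b)) < 1" using d(1) that by (intro d(2)) auto
      then show ?thesis by (simp add: dist_real_def)
    qed
  qed (use d in auto)
qed

section \<open>The orbit space\<close>

text \<open>This is the closed graph property. If \<open>y\<close> were outside the closed set
  \<open>f x\<close>, upper semicontinuity would eventually confine \<open>b n\<close> to within
  half the distance from \<open>y\<close> to \<open>f x\<close>, and \<open>b\<close> could not
  converge to \<open>y\<close>.\<close>

lemma upper_semicontinuous_limit:
  fixes X :: "'a::metric_space set"
  assumes "compact X" "multivalued_map X f" "x \<in> X" "\<And>n. a n \<in> X"
    and "a \<longlonglongrightarrow> x" "b \<longlonglongrightarrow> y" "\<And>n. b n \<in> f (a n)"
  shows "y \<in> f x"
proof (rule ccontr)
  assume "y \<notin> f x"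
  have fx: "f x \<noteq> {}" "closedin (top_of_set X) (f x)"
    using assms(2,3) by (auto simp: multivalued_map_def)
  have "f x \<subseteq> X" using closedin_imp_subset[OF fx(2)] .
  have "closed (f x)"
    using closedin_compact[OF assms(1) fx(2)] by (rule compact_imp_closed)
  have pos: "infdist y (f x) > 0"
    using \<open>y \<notin> f x\<close> \<open>closed (f x)\<close> fx(1) by (simp add: infdist_pos_not_in_closed)
  define r where "r = infdist y (f x) / 2"
  define U where "U = X \<inter> {z. infdist z (f x) < r}"
  have "open {z. infdist z (f x) < r}"
    by (intro open_Collect_less continuous_intros)
  then have "openin (top_of_set X) U" unfolding U_def by blast
  moreover have "f x \<subseteq> U" using \<open>f x \<subseteq> X\<close> pos by (auto simp: U_def r_def)
  ultimately obtain V where V: "openin (top_of_set X) V" "x \<in> V" "\<And>z. z \<in> V \<Longrightarrow> f z \<subseteq> U"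
    using assms(2,3) unfolding multivalued_map_def upper_semicontinuous_def by metis
  then obtain W where W: "open W" "V = X \<inter> W" by (auto simp: openin_open)
  then have "\<forall>\<^sub>F n in sequentially. a n \<in> W" using assms(5) V(2) by (auto simp: tendsto_def)
  then have "\<forall>\<^sub>F n in sequentially. infdist (b n) (f x) \<le> r"
  proof (rule eventually_mono)
    fix n assume "a n \<in> W"
    then have "b n \<in> U" using V(3) W(2) assms(4,7) by blast
    then show "infdist (b n) (f x) \<le> r" by (auto simp: U_def)
  qed
  moreover have "(\<lambda>n. infdist (b n) (f x)) \<longlonglongrightarrow> infdist y (f x)"
    using assms(6) by (intro tendsto_intros)
  ultimately have "infdist y (f x) \<le> r"
    by (intro tendsto_upperbound[OF _ _ trivial_limit_sequentially])
  then show False using pos by (simp add: r_def)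
qed

lemma continuous_on_coordinate: "continuous_on A (\<lambda>x. x i :: 'b::topological_space)"
  by (rule continuous_on_subset[OF continuous_on_product_coordinates]) simp

lemma tendsto_coordinate:
  fixes u :: "nat \<Rightarrow> 'i \<Rightarrow> 'b::topological_space"
  assumes "u \<longlonglongrightarrow> x"
  shows "(\<lambda>n. u n i) \<longlonglongrightarrow> x i"
  by (rule continuous_on_tendsto_compose[where f = "\<lambda>x. x i",
        OF continuous_on_product_coordinates assms]) simp_all

text \<open>This turns the product topologies of the definitions into subspaces of a function type,
  where \<open>compact\<close> and \<open>continuous_on\<close> apply.\<close>

lemma product_top_of_set:
  fixes A :: "'b::topological_space set"
  shows "product_topology (\<lambda>_::'i. top_of_set A) UNIV = top_of_set (\<Pi>\<^sub>E i\<in>UNIV. A)"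
  using subtopology_product_topology[of "\<lambda>_::'i. euclidean :: 'b topology" UNIV "\<lambda>_. A"]
  by (simp add: euclidean_product_topology)

lemma orbit_space_eq: "orbit_space X f = top_of_set (Orb X f)"
proof -
  have "(\<Pi>\<^sub>E i\<in>UNIV. X) \<inter> Orb X f = Orb X f" by (auto simp: Orb_def)
  then show ?thesis
    unfolding orbit_space_def product_top_of_set by (simp add: subtopology_subtopology)
qed

lemma discrete_topology_eq:
  fixes S :: "'s::discrete_topology set"
  shows "discrete_topology S = top_of_set S"
  by (auto simp: topology_eq openin_open open_discrete)

lemma SFT_space_eq:
  fixes S :: "'s::discrete_topology set"
  shows "SFT_space S F = top_of_set {x. (\<forall>i. x i \<in> S) \<and> (\<forall>w\<in>F. \<not> contains_word x w)}"
proof -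
  have "(\<Pi>\<^sub>E i\<in>UNIV. S) \<inter> {x. (\<forall>i. x i \<in> S) \<and> (\<forall>w\<in>F. \<not> contains_word x w)} =
      {x. (\<forall>i. x i \<in> S) \<and> (\<forall>w\<in>F. \<not> contains_word x w)}" by auto
  then show ?thesis
    unfolding SFT_space_def discrete_topology_eq
    by (simp add: product_top_of_set subtopology_subtopology)
qed

text \<open>By Tychonoff the full product is compact, and the closed graph of \<open>f\<close>,
  applied coordinate by coordinate, makes the orbits a closed subset.\<close>

lemma compact_Orb:
  fixes X :: "'a::metric_space set"
  assumes "compact X" "multivalued_map X f"
  shows "compact (Orb X f)"
proof -
  have "compactin (product_topology (\<lambda>_::nat. euclidean :: 'a topology) UNIV) (\<Pi>\<^sub>E i\<in>UNIV. X)"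
    using assms(1) by (simp add: compactin_PiE)
  then have "compact (\<Pi>\<^sub>E i\<in>(UNIV::nat set). X)"
    by (simp add: euclidean_product_topology)
  moreover have "closed (Orb X f)"
    unfolding closed_sequential_limits
  proof (intro allI impI, elim conjE)
    fix u x assume u: "\<forall>n. u n \<in> Orb X f" "u \<longlonglongrightarrow> x"
    have lim: "(\<lambda>n. u n i) \<longlonglongrightarrow> x i" for i using u(2) by (rule tendsto_coordinate)
    have uX: "u n i \<in> X" "u n (Suc i) \<in> f (u n i)" for n i using u(1) by (auto simp: Orb_def)
    have xX: "x i \<in> X" for i
      by (rule closed_sequentially[OF compact_imp_closed[OF assms(1)] _ lim]) (rule uX(1))
    have "x (Suc i) \<in> f (x i)" for i
      using upper_semicontinuous_limit[OF assms xX uX(1) lim lim uX(2)] .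
    then show "x \<in> Orb X f" using xX by (auto simp: Orb_def)
  qed
  moreover have "Orb X f \<subseteq> (\<Pi>\<^sub>E i\<in>UNIV. X)" by (auto simp: Orb_def)
  ultimately show ?thesis by (metis compact_Int_closed inf.absorb_iff2)
qed

lemma Orb_shift: "u \<in> Orb X f \<Longrightarrow> (\<lambda>j. u (i + j)) \<in> Orb X f"
  by (auto simp: Orb_def)

section \<open>Itineraries\<close>

text \<open>This is the form in which expansivity enters from here on. Only first points are
  compared; shifting the orbits extends the conclusion to all coordinates.\<close>

definition separating_coding :: "'a::metric_space set \<Rightarrow> ('a \<Rightarrow> 'a set) \<Rightarrow> ('a \<Rightarrow> nat) \<Rightarrow> bool" where
  "separating_coding X f \<pi> \<longleftrightarrow> continuous_on X \<pi> \<and>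
     (\<forall>u\<in>Orb X f. \<forall>v\<in>Orb X f. (\<forall>i. \<pi> (u i) = \<pi> (v i)) \<longrightarrow> u 0 = v 0)"

lemma expansive_imp_separating_coding:
  fixes X :: "'a::metric_space set"
  assumes "compact X" "totally_disconnected X" "expansive X f"
  obtains \<pi> where "separating_coding X f \<pi>"
proof -
  obtain \<delta> where \<delta>: "\<delta> > 0" and exp: "\<forall>x\<in>X. \<forall>y\<in>X.
      (\<exists>u\<in>Orb X f. \<exists>v\<in>Orb X f. u 0 = x \<and> v 0 = y \<and> (\<forall>i. dist (u i) (v i) \<le> \<delta>)) \<longrightarrow> x = y"
    using assms(3) unfolding expansive_def by auto
  obtain \<pi> :: "'a \<Rightarrow> nat" where \<pi>: "continuous_on X \<pi>"
    "\<And>a b. a \<in> X \<Longrightarrow> b \<in> X \<Longrightarrow> \<pi> a = \<pi> b \<Longrightarrow> dist a b \<le> \<delta>"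
    using clopen_coding_exists[OF assms(1,2) \<delta>] by metis
  have "u 0 = v 0" if uv: "u \<in> Orb X f" "v \<in> Orb X f" "\<forall>i. \<pi> (u i) = \<pi> (v i)" for u v
  proof -
    have inX: "u i \<in> X" "v i \<in> X" for i using uv by (simp_all add: Orb_def)
    then have "\<forall>i. dist (u i) (v i) \<le> \<delta>" using \<pi>(2) uv(3) by simp
    with uv(1,2) show ?thesis using exp[rule_format, OF inX] by metis
  qed
  with \<pi>(1) show thesis by (intro that[of \<pi>]) (simp add: separating_coding_def)
qed

lemma separating_coding_inj:
  assumes "separating_coding X f \<pi>"
  shows "inj_on (\<lambda>x i. \<pi> (x i)) (Orb X f)"
proof (rule inj_onI)
  fix u v assume uv: "u \<in> Orb X f" "v \<in> Orb X f" "(\<lambda>i. \<pi> (u i)) = (\<lambda>i. \<pi> (v i))"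
  show "u = v"
  proof
    fix i
    have "\<forall>j. \<pi> (u (i + j)) = \<pi> (v (i + j))" using fun_cong[OF uv(3)] by simp
    then have "u (i + 0) = v (i + 0)"
      using assms[unfolded separating_coding_def, THEN conjunct2, rule_format,
          OF Orb_shift[OF uv(1), of i] Orb_shift[OF uv(2), of i]] by simp
    then show "u i = v i" by simp
  qed
qed

text \<open>Otherwise, for each \<open>N\<close>, two orbits agree in code up to \<open>N\<close>
  while their first points stay \<open>\<eta>\<close> apart. A limit of such pairs consists of two
  orbits with the same itinerary and different first points.\<close>

lemma separating_coding_uniform:
  fixes X :: "'a::metric_space set"
  assumes "compact X" "multivalued_map X f" "separating_coding X f \<pi>" "\<eta> > 0"
  obtains N where "\<And>u v. u \<in> Orb X f \<Longrightarrow> v \<in> Orb X f \<Longrightarrow> (\<forall>j\<le>N. \<pi> (u j) = \<pi> (v j)) \<Longrightarrow>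
    dist (u 0) (v 0) < \<eta>"
proof (rule ccontr)
  assume no: "\<not> thesis"
  have "\<exists>u v. u \<in> Orb X f \<and> v \<in> Orb X f \<and> (\<forall>j\<le>N. \<pi> (u j) = \<pi> (v j)) \<and>
      \<eta> \<le> dist (u 0) (v 0)" for N
  proof (rule ccontr)
    assume "\<not> ?thesis"
    then have "thesis" by (intro that[of N]) (auto simp: not_le)
    with no show False ..
  qed
  then obtain u v where uv: "\<And>N. u N \<in> Orb X f" "\<And>N. v N \<in> Orb X f"
    "\<And>N j. j \<le> N \<Longrightarrow> \<pi> (u N j) = \<pi> (v N j)" "\<And>N. \<eta> \<le> dist (u N 0) (v N 0)"
    by metis
  have orb: "compact (Orb X f)" using assms(1,2) by (rule compact_Orb)
  have sc: "seq_compact (Orb X f \<times> Orb X f)"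
    by (rule compact_imp_seq_compact[OF compact_Times[OF orb orb]])
  have uv': "\<forall>n. (u n, v n) \<in> Orb X f \<times> Orb X f" using uv(1,2) by simp
  obtain l and r :: "nat \<Rightarrow> nat" where lr: "l \<in> Orb X f \<times> Orb X f" "strict_mono r"
      "((\<lambda>n. (u n, v n)) \<circ> r) \<longlonglongrightarrow> l"
    using sc[unfolded seq_compact_def, rule_format, of "\<lambda>n. (u n, v n)", OF uv'[rule_format]]
    by blast
  obtain x y where l: "l = (x, y)" by force
  have xy: "x \<in> Orb X f" "y \<in> Orb X f" using lr(1) l by auto
  have "(\<lambda>n. u (r n)) \<longlonglongrightarrow> x" and "(\<lambda>n. v (r n)) \<longlonglongrightarrow> y"
    using tendsto_fst[OF lr(3)] tendsto_snd[OF lr(3)] by (simp_all add: l o_def)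
  from this[THEN tendsto_coordinate]
  have lim: "(\<lambda>n. u (r n) j) \<longlonglongrightarrow> x j" "(\<lambda>n. v (r n) j) \<longlonglongrightarrow> y j" for j
    by blast+
  have "\<pi> (x j) = \<pi> (y j)" for j
  proof -
    have c: "continuous_on X \<pi>" using assms(3) by (simp add: separating_coding_def)
    have inX: "w i \<in> X" if "w \<in> Orb X f" for w i using that by (simp add: Orb_def)
    have "(\<lambda>n. \<pi> (u (r n) j)) \<longlonglongrightarrow> \<pi> (x j)" "(\<lambda>n. \<pi> (v (r n) j)) \<longlonglongrightarrow> \<pi> (y j)"
      by (rule continuous_on_tendsto_compose[OF c lim(1)] continuous_on_tendsto_compose[OF c lim(2)],
          simp_all add: inX xy uv(1,2))+
    \<comment> \<open>Once \<open>n \<ge> j\<close>, also \<open>r n \<ge> j\<close>, so coordinate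
      \<open>j\<close> lies in the range where the codes agree.\<close>
    moreover have "\<forall>\<^sub>F n in sequentially. \<pi> (u (r n) j) = \<pi> (v (r n) j)"
      using eventually_ge_at_top[of j]
      by eventually_elim (meson uv(3) lr(2) order_trans seq_suble)
    ultimately show ?thesis
      by (metis LIMSEQ_unique tendsto_cong)
  qed
  then have "x 0 = y 0" using assms(3) xy by (simp add: separating_coding_def)
  moreover have "\<eta> \<le> dist (x 0) (y 0)"
    using uv(4) by (intro tendsto_lowerbound[OF tendsto_dist[OF lim(1)[of 0] lim(2)[of 0]]]) auto
  ultimately show False using assms(4) by simp
qed

text \<open>The constants are chosen backwards: \<open>\<epsilon>\<close> so small that
  \<open>\<epsilon>\<close>-close points share a code, \<open>\<eta>\<close> from shadowing at scale
  \<open>\<epsilon>\<close>, and \<open>N\<close> so that agreement up to \<open>N\<close> brings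
  first points within \<open>\<eta>\<close>.\<close>

lemma itineraries_determined_by_words:
  fixes X :: "'a::metric_space set"
  assumes "compact X" "multivalued_map X f" "shadowing_property X f" "separating_coding X f \<pi>"
  obtains M where "\<And>s. (\<And>i. \<exists>u\<in>Orb X f. \<forall>j\<le>M. \<pi> (u j) = s (i + j)) \<Longrightarrow>
    \<exists>y\<in>Orb X f. \<forall>i. \<pi> (y i) = s i"
proof -
  have "continuous_on X \<pi>" using assms(4) by (simp add: separating_coding_def)
  then obtain \<epsilon> where \<epsilon>: "\<epsilon> > 0" "\<And>a b. a \<in> X \<Longrightarrow> b \<in> X \<Longrightarrow> dist a b \<le> \<epsilon> \<Longrightarrow> \<pi> a = \<pi> b"
    using locally_constant_uniform[OF assms(1)] by metis
  obtain \<eta> where \<eta>: "\<eta> > 0" "\<And>x. (\<And>i. x i \<in> X) \<Longrightarrow> (\<And>i. infdist (x (Suc i)) (f (x i)) < \<eta>) \<Longrightarrow>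
      \<exists>y\<in>Orb X f. \<forall>i. dist (x i) (y i) \<le> \<epsilon>"
    using assms(3) \<epsilon>(1) unfolding shadowing_property_def by metis
  obtain N where N: "\<And>u v. u \<in> Orb X f \<Longrightarrow> v \<in> Orb X f \<Longrightarrow> (\<forall>j\<le>N. \<pi> (u j) = \<pi> (v j)) \<Longrightarrow>
      dist (u 0) (v 0) < \<eta>"
    using separating_coding_uniform[OF assms(1,2,4) \<eta>(1)] by metis
  \<comment> \<open>One symbol beyond \<open>N\<close> is needed: the tail of \<open>u i\<close>
    from its second point must agree with \<open>u (Suc i)\<close> at positions \<open>0\<close> to
    \<open>N\<close>, which uses positions \<open>1\<close> to \<open>Suc N\<close> of
    \<open>u i\<close>.\<close>
  show thesis
  proof (rule that[of "Suc N"])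
    fix s assume "\<And>i. \<exists>u\<in>Orb X f. \<forall>j\<le>Suc N. \<pi> (u j) = s (i + j)"
    then obtain u where u: "\<And>i. u i \<in> Orb X f" "\<And>i j. j \<le> Suc N \<Longrightarrow> \<pi> (u i j) = s (i + j)"
      by metis
    have uX: "u i j \<in> X" "u i (Suc j) \<in> f (u i j)" for i j using u(1) by (auto simp: Orb_def)
    have "infdist (u (Suc i) 0) (f (u i 0)) < \<eta>" for i
    proof -
      \<comment> \<open>The second point of \<open>u i\<close> lies in \<open>f (u i 0)\<close>, so
        its distance to \<open>u (Suc i) 0\<close> bounds the error of the pseudo-orbit.\<close>
      have "dist (u (Suc i) 0) (u i (1 + 0)) < \<eta>"
        using u(2)[of _ "Suc i"] u(2)[of "Suc _" i]
        by (intro N[OF u(1) Orb_shift[OF u(1)]]) auto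
      moreover have "infdist (u (Suc i) 0) (f (u i 0)) \<le> dist (u (Suc i) 0) (u i (1 + 0))"
        using uX(2)[of i 0] by (auto intro: infdist_le)
      ultimately show ?thesis by linarith
    qed
    then obtain y where y: "y \<in> Orb X f" "\<And>i. dist (u i 0) (y i) \<le> \<epsilon>"
      using \<eta>(2)[of "\<lambda>i. u i 0"] uX(1) by blast
    have "\<pi> (y i) = s i" for i
    proof -
      have "\<pi> (u i 0) = \<pi> (y i)" using y uX(1) by (intro \<epsilon>(2)) (auto simp: Orb_def)
      then show ?thesis using u(2)[of 0 i] by simp
    qed
    then show "\<exists>y\<in>Orb X f. \<forall>i. \<pi> (y i) = s i" using y(1) by blast
  qed
qed

section \<open>The itinerary map as a conjugacy onto a subshift of finite type\<close>

theorem theorem4p13: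
  fixes X :: "'a::metric_space set" and f :: "'a \<Rightarrow> 'a set"
  assumes "compact X"
    and "totally_disconnected X"
    and "multivalued_map X f"
    and "expansive X f"
    and "shadowing_property X f"
  shows "\<exists>(Y :: (nat \<Rightarrow> nat) topology) T.
           subshift_of_finite_type Y T \<and> conjugate (orbit_space X f) left_shift Y T"
proof -
  obtain \<pi> where \<pi>: "separating_coding X f \<pi>"
    using expansive_imp_separating_coding assms(1,2,4) by metis
  then have c: "continuous_on X \<pi>" by (simp add: separating_coding_def)
  obtain M where M: "\<And>s. (\<And>i. \<exists>u\<in>Orb X f. \<forall>j\<le>M. \<pi> (u j) = s (i + j)) \<Longrightarrow>
      \<exists>y\<in>Orb X f. \<forall>i. \<pi> (y i) = s i"
    using itineraries_determined_by_words[OF assms(1,3,5) \<pi>] by metis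
  \<comment> \<open>The extra symbol \<open>0\<close> keeps the alphabet non-empty when \<open>X\<close> is empty.\<close>
  define S where "S = insert 0 (\<pi> ` X)"
  \<comment> \<open>The forbidden words are those that begin no itinerary; as orbits can be shifted,
    they occur nowhere in an itinerary. If \<open>X\<close> is empty, all words of length
    \<open>M + 1\<close> over \<open>S\<close> are forbidden and \<open>Z\<close> is empty
    too.\<close>
  define F where "F = {w. length w = M + 1 \<and> set w \<subseteq> S \<and>
      \<not> (\<exists>u\<in>Orb X f. \<forall>j<length w. \<pi> (u j) = w ! j)}"
  define Z where "Z = {s. (\<forall>i. s i \<in> S) \<and> (\<forall>w\<in>F. \<not> contains_word s w)}"
  define h where "h x = (\<lambda>i. \<pi> (x i))" for x :: "nat \<Rightarrow> 'a"
  \<comment> \<open>The image of \<open>X\<close> is compact in a discrete space, hence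
    finite.\<close>
  have "finite S"
    using compact_continuous_image[OF c assms(1)]
    unfolding S_def finite_insert compact_space_discrete_topology[symmetric] discrete_topology_eq
    by (simp add: compact_space_subtopology)
  then have sft: "subshift_of_finite_type (SFT_space S F) left_shift"
    unfolding subshift_of_finite_type_def
    by (intro exI[of _ S] exI[of _ M] exI[of _ F]) (auto simp: S_def F_def)
  have sub: "h ` Orb X f \<subseteq> Z"
  proof (clarsimp simp: Z_def, intro conjI allI ballI notI)
    fix x i assume "x \<in> Orb X f"
    then show "h x i \<in> S" by (auto simp: h_def S_def Orb_def)
  next
    fix x w assume x: "x \<in> Orb X f" and w: "w \<in> F" "contains_word (h x) w"
    then obtain i where "\<forall>j<length w. \<pi> (x (i + j)) = w ! j"
      by (auto simp: contains_word_def h_def)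
    then show False using Orb_shift[OF x, of i] w(1) by (auto simp: F_def)
  qed
  \<comment> \<open>Each window of length \<open>M + 1\<close> in \<open>s\<close> is not forbidden,
    so some orbit begins with it; the choice of \<open>M\<close> then yields one orbit for all of
    \<open>s\<close>.\<close>
  moreover have "Z \<subseteq> h ` Orb X f"
  proof
    fix s assume s: "s \<in> Z"
    have "\<exists>u\<in>Orb X f. \<forall>j\<le>M. \<pi> (u j) = s (i + j)" for i
    proof -
      let ?w = "map (\<lambda>j. s (i + j)) [0..<M + 1]"
      have nth: "?w ! j = s (i + j)" if "j \<le> M" for j
        using that by (simp add: nth_append del: upt_Suc)
      have "contains_word s ?w"
        unfolding contains_word_def using nth by (intro exI[of _ i]) (auto simp del: upt_Suc)
      then have "?w \<notin> F" using s by (auto simp: Z_def)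
      moreover have "set ?w \<subseteq> S" using s by (auto simp: Z_def)
      ultimately obtain u where "u \<in> Orb X f" "\<forall>j<length ?w. \<pi> (u j) = ?w ! j"
        by (auto simp: F_def simp del: upt_Suc)
      then show ?thesis using nth by (intro bexI[of _ u]) (auto simp del: upt_Suc)
    qed
    then obtain y where "y \<in> Orb X f" "\<forall>i. \<pi> (y i) = s i" using M by metis
    then show "s \<in> h ` Orb X f" by (auto simp: h_def image_iff fun_eq_iff intro!: bexI[of _ y])
  qed
  ultimately have onto: "h ` Orb X f = Z" by blast
  have "continuous_on (Orb X f) (\<lambda>x. \<pi> (x i))" for i
    by (rule continuous_on_compose2[OF c continuous_on_coordinate]) (auto simp: Orb_def)
  then have "continuous_on (Orb X f) h"
    unfolding h_def by (rule continuous_on_coordinatewise_then_product)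
  moreover have "Hausdorff_space (top_of_set Z)"
    unfolding euclidean_product_topology[symmetric]
    by (simp add: Hausdorff_space_subtopology Hausdorff_space_product_topology
        discrete_topology_eq[of UNIV, simplified, symmetric])
  moreover have "inj_on h (Orb X f)"
    using separating_coding_inj[OF \<pi>] by (simp add: h_def[abs_def])
  \<comment> \<open>A continuous bijection from a compact space onto a Hausdorff space is a
    homeomorphism.\<close>
  ultimately have "homeomorphic_map (top_of_set (Orb X f)) (top_of_set Z) h"
    using compact_Orb[OF assms(1,3)] onto
    by (intro continuous_imp_homeomorphic_map) (auto simp: compact_space_subtopology)
  then have "conjugate (orbit_space X f) left_shift (SFT_space S F) left_shift"
    unfolding conjugate_def orbit_space_eq SFT_space_eq Z_def
    by (intro exI[of _ h]) (auto simp: h_def left_shift_def)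
  then show ?thesis using sft by blast
qed

end
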